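(* Let $h\in\omega^\omega$ with $h(n)\geq1$ for all $n$. Then: (1) $\mathrm{minGPr}_h\leq\mathrm{minGLc}$ and $\mathrm{supGPr}_h\geq\mathrm{supGLc}$; in particular, if $h$ goes to infinity, $\mathrm{minGPr}_h=\mathrm{minGLc}$ and $\mathrm{supGPr}_h=\mathrm{supGLc}$. (2) $\mathfrak{e}_{ubd}=\mathrm{minLPr}_h=\mathrm{minLLc}$ and $\mathfrak{pr}_{ubd}=\mathrm{supLPr}_h=\mathrm{supLLc}$. (3) $\mathrm{minIPr}_h=\mathrm{minILc}$ and $\mathrm{supIPr}_h=\mathrm{supILc}$.
   Context: Convention: $1\leq h(n)<b(n)$, so minima/suprema over $b\in\omega^\omega$ range over $b>h$ pointwise. For $b,h\in\omega^\omega$: $\prod b=\prod_nb(n)$, $\mathcal{S}(b,h)=\prod_n[b(n)]^{\leq h(n)}$, $\mathrm{Seq}_{<\omega}(b)=\bigcup_n\prod_{i<n}b(i)$. For a relational system $\langle X,Y,\sqsubset\rangle$, $\mathfrak{b}$ is the least size of $F\subseteq X$ with no single $y$ meeting all of $F$, $\mathfrak{d}$ the least size of $F\subseteq Y$ meeting every $x$. Localization: $\mathfrak{b}^{\mathrm{GLc}}_{b,h},\mathfrak{d}^{\mathrm{GLc}}_{b,h}$ are those of $\langle\prod b,\mathcal{S}(b,h),\in^*\rangle$ ($x\in^*\varphi$ iff $x(n)\in\varphi(n)$ for almost all $n$); $\mathfrak{b}^{\mathrm{LLc}}_{b,h},\mathfrak{d}^{\mathrm{LLc}}_{b,h}$ those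 of $\langle\prod b,[\omega]^\omega\times\mathcal{S}(b,h),x\in^*_D\varphi\rangle$ ($x(n)\in\varphi(n)$ for almost all $n\in D$); $\mathfrak{b}^{\mathrm{ILc}}_{b,h},\mathfrak{d}^{\mathrm{ILc}}_{b,h}$ those of $\langle\prod b,\mathcal{S}(b,h),\in^\infty\rangle$ (infinitely many $n$). Prediction: a global $(b,h)$-predictor is $\pi$ on $\mathrm{Seq}_{<\omega}(b)$ with $\pi(\sigma)\subseteq b(n)$, $|\pi(\sigma)|\leq h(n)$ for $\sigma\in\prod_{i<n}b(i)$; $f\sqsubset_D\pi$ iff $f(n)\in\pi(f\restriction n)$ for almost all $n\in D$. $\mathfrak{e}^{\mathrm{G}}_{b,h},\mathfrak{pr}^{\mathrm{G}}_{b,h}$ are $\mathfrak{b},\mathfrak{d}$ of $\langle\prod b,\text{predictors},\sqsubset_\omega\rangle$; $\mathfrak{e}^{\mathrm{L}}_{b,h},\mathfrak{pr}^{\mathrm{L}}_{b,h}$ of $\langle\prod b,[\omega]^\omega\times\text{predictors},f\sqsubset_D\pi\rangle$; $\mathfrak{e}^{\mathrm{I}}_{b,h},\mathfrak{pr}^{\mathrm{I}}_{b,h}$ of $\langle\prod b,\text{predictors},\exists D\in[\omega]^\omega\,f\sqsubset_D\pi\rangle$. Limits: $\mathrm{minGPr}_h=\min_b\mathfrak{e}^{\mathrm{G}}_{b,h}$, $\mathrm{supGPr}_h=\sup_b\mathfrak{pr}^{\mathrm{G}}_{b,h}$, similarly $\mathrm{minLPr}_h,\mathrm{supLPr}_h,\mathrm{minIPr}_h,\mathrm{supIPr}_h$;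 $\mathrm{minGLc}_{h'}=\min_b\mathfrak{b}^{\mathrm{GLc}}_{b,h'}$, $\mathrm{supGLc}_{h'}=\sup_b\mathfrak{d}^{\mathrm{GLc}}_{b,h'}$, and similarly $\mathrm{minLLc}_{h'},\mathrm{supLLc}_{h'},\mathrm{minILc}_{h'},\mathrm{supILc}_{h'}$. It is known that $\mathrm{minGLc}_{h'},\mathrm{supGLc}_{h'},\mathrm{minLLc}_{h'},\mathrm{supLLc}_{h'}$ do not depend on $h'$ as long as $h'$ goes to infinity, and $\mathrm{minILc}_{h'},\mathrm{supILc}_{h'}$ do not depend on $h'\geq1$; these common values are denoted $\mathrm{minGLc},\mathrm{supGLc},\mathrm{minLLc},\mathrm{supLLc},\mathrm{minILc},\mathrm{supILc}$. Finally $\mathfrak{e}_{ubd}=\min_b\mathfrak{e}^{\mathrm{L}}_{b,1}$ and $\mathfrak{pr}_{ubd}=\sup_b\mathfrak{pr}^{\mathrm{L}}_{b,1}$ (over $b\in\omega^\omega$, $b\geq2$). *)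

theory Defs
  imports Complex_Main "HOL-Library.FuncSet" "HOL-Library.Infinite_Set"
begin

unbundle cardinal_syntax

text \<open>
  Cardinals are cardinal-order relations, compared across types by \<open>\<le>o\<close> and \<open>=o\<close>.
  The operator \<open>card_min\<close> picks a \<open>\<le>o\<close>-least member of a nonempty set of cardinals.
  The operator \<open>card_sup\<close> is the least cardinal above all members. Restricting the upper
  bounds to the type \<open>'a\<close> is harmless: the cardinal of the whole type is one of them, and any
  smaller upper bound living on another type has a copy on \<open>'a\<close>.
\<close>

definition card_min :: "'a rel set \<Rightarrow> 'a rel" where
  "card_min C = (SOME r. r \<in> C \<and> (\<forall>s\<in>C. r \<le>o s))"

definition card_sup :: "'a rel set \<Rightarrow> 'a rel" where
  "card_sup C = card_min {r. Card_order r \<and> (\<forall>s\<in>C. s \<le>o r)}"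

lemma card_min_least:
  assumes "C \<noteq> {}" "\<forall>r\<in>C. Card_order r"
  shows "card_min C \<in> C" "\<forall>s\<in>C. card_min C \<le>o s"
proof -
  have "\<exists>r. r \<in> C \<and> (\<forall>s\<in>C. r \<le>o s)"
    using exists_minim_Card_order[OF assms] by blast
  from someI_ex[OF this] show "card_min C \<in> C" "\<forall>s\<in>C. card_min C \<le>o s"
    unfolding card_min_def by blast+
qed

lemma card_sup_least_upper_bound:
  fixes C :: "'a rel set" and t :: "'b rel"
  assumes C: "\<forall>r\<in>C. Card_order r"
  shows "Card_order (card_sup C)"
    and "\<forall>s\<in>C. s \<le>o card_sup C"
    and "Card_order t \<Longrightarrow> \<forall>s\<in>C. s \<le>o t \<Longrightarrow> card_sup C \<le>o t"
proof -
  let ?U = "{r::'a rel. Card_order r \<and> (\<forall>s\<in>C. s \<le>o r)}"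
  have top: "s \<le>o |UNIV::'a set|" if "Card_order s" for s :: "'a rel"
    by (rule ordIso_ordLeq_trans[OF ordIso_symmetric[OF card_of_Field_ordIso[OF that]]
          card_of_mono1[OF subset_UNIV]])
  have U: "|UNIV::'a set| \<in> ?U"
    using C top card_of_Card_order by auto
  have ne: "?U \<noteq> {}" and CU: "\<forall>r\<in>?U. Card_order r"
    using U by (blast, simp)
  have mem: "card_sup C \<in> ?U"
    unfolding card_sup_def by (rule card_min_least(1)[OF ne CU])
  have least: "\<forall>s\<in>?U. card_sup C \<le>o s"
    unfolding card_sup_def by (rule card_min_least(2)[OF ne CU])
  show 1: "Card_order (card_sup C)" and "\<forall>s\<in>C. s \<le>o card_sup C"
    using mem by auto
  show "card_sup C \<le>o t" if t: "Card_order t" "\<forall>s\<in>C. s \<le>o t"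
  proof (cases "t \<le>o |UNIV::'a set|")
    case True
    then have "|Field t| \<le>o |UNIV::'a set|"
      by (rule ordIso_ordLeq_trans[OF card_of_Field_ordIso[OF t(1)]])
    then obtain f :: "'b \<Rightarrow> 'a" where f: "inj_on f (Field t)"
      using card_of_ordLeq[of "Field t" "UNIV::'a set"] by blast
    have iso: "t =o |f ` Field t|"
      by (rule ordIso_transitive[OF ordIso_symmetric[OF card_of_Field_ordIso[OF t(1)]]
            card_of_ordIsoI[OF inj_on_imp_bij_betw[OF f]]])
    then have "|f ` Field t| \<in> ?U"
      using t(2) ordLeq_ordIso_trans[OF _ iso] card_of_Card_order by auto
    with least have "card_sup C \<le>o |f ` Field t|" by blast
    then show ?thesis by (rule ordLeq_ordIso_trans[OF _ ordIso_symmetric[OF iso]])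
  next
    case False
    then have "|UNIV::'a set| \<le>o t"
      using ordLeq_total[of t "|UNIV::'a set|"] t(1) card_of_Well_order
      unfolding card_order_on_def by blast
    then show ?thesis by (rule ordLeq_transitive[OF top[OF 1]])
  qed
qed

subsection \<open>Relational systems\<close>

definition bnum :: "'x set \<Rightarrow> 'y set \<Rightarrow> ('x \<Rightarrow> 'y \<Rightarrow> bool) \<Rightarrow> 'x rel" where
  "bnum X Y R = card_min {|F| |F. F \<subseteq> X \<and> \<not> (\<exists>y\<in>Y. \<forall>x\<in>F. R x y)}"

definition dnum :: "'x set \<Rightarrow> 'y set \<Rightarrow> ('x \<Rightarrow> 'y \<Rightarrow> bool) \<Rightarrow> 'y rel" where
  "dnum X Y R = card_min {|F| |F. F \<subseteq> Y \<and> (\<forall>x\<in>X. \<exists>y\<in>F. R x y)}"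

definition inf_subsets :: "nat set set" where
  "inf_subsets = {D. infinite D}"

text \<open>A natural number \<open>k\<close> is identified with the set \<open>{..<k}\<close> of its predecessors.\<close>

definition fprod :: "(nat \<Rightarrow> nat) \<Rightarrow> (nat \<Rightarrow> nat) set" where
  "fprod b = {x. \<forall>n. x n < b n}"

subsection \<open>Localization\<close>

definition slaloms :: "(nat \<Rightarrow> nat) \<Rightarrow> (nat \<Rightarrow> nat) \<Rightarrow> (nat \<Rightarrow> nat set) set" where
  "slaloms b h = {\<phi>. \<forall>n. \<phi> n \<subseteq> {..<b n} \<and> card (\<phi> n) \<le> h n}"

definition loc_on :: "nat set \<Rightarrow> (nat \<Rightarrow> nat) \<Rightarrow> (nat \<Rightarrow> nat set) \<Rightarrow> bool" where
  "loc_on D x \<phi> \<longleftrightarrow> (\<forall>\<^sub>\<infinity>n. n \<in> D \<longrightarrow> x n \<in> \<phi> n)"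

definition loc_inf :: "(nat \<Rightarrow> nat) \<Rightarrow> (nat \<Rightarrow> nat set) \<Rightarrow> bool" where
  "loc_inf x \<phi> \<longleftrightarrow> (\<exists>\<^sub>\<infinity>n. x n \<in> \<phi> n)"

definition bGLc where "bGLc b h = bnum (fprod b) (slaloms b h) (loc_on UNIV)"
definition dGLc where "dGLc b h = dnum (fprod b) (slaloms b h) (loc_on UNIV)"
definition bLLc where
  "bLLc b h = bnum (fprod b) (inf_subsets \<times> slaloms b h) (\<lambda>x (D, \<phi>). loc_on D x \<phi>)"
definition dLLc where
  "dLLc b h = dnum (fprod b) (inf_subsets \<times> slaloms b h) (\<lambda>x (D, \<phi>). loc_on D x \<phi>)"
definition bILc where "bILc b h = bnum (fprod b) (slaloms b h) loc_inf"
definition dILc where "dILc b h = dnum (fprod b) (slaloms b h) loc_inf"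

subsection \<open>Prediction\<close>

text \<open>Elements of \<open>\<Prod>i<n. b i\<close> are lists of length \<open>n\<close>, and \<open>f\<close> restricted to \<open>n\<close> is
  \<open>map f [0..<n]\<close>.\<close>

definition Seq :: "(nat \<Rightarrow> nat) \<Rightarrow> nat list set" where
  "Seq b = {\<sigma>. \<forall>i<length \<sigma>. \<sigma> ! i < b i}"

definition predictors :: "(nat \<Rightarrow> nat) \<Rightarrow> (nat \<Rightarrow> nat) \<Rightarrow> (nat list \<Rightarrow> nat set) set" where
  "predictors b h =
     (\<Pi>\<^sub>E \<sigma>\<in>Seq b. {A. A \<subseteq> {..<b (length \<sigma>)} \<and> card A \<le> h (length \<sigma>)})"

definition pred_on :: "nat set \<Rightarrow> (nat \<Rightarrow> nat) \<Rightarrow> (nat list \<Rightarrow> nat set) \<Rightarrow> bool" where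
  "pred_on D f \<pi> \<longleftrightarrow> (\<forall>\<^sub>\<infinity>n. n \<in> D \<longrightarrow> f n \<in> \<pi> (map f [0..<n]))"

definition eG where "eG b h = bnum (fprod b) (predictors b h) (pred_on UNIV)"
definition prG where "prG b h = dnum (fprod b) (predictors b h) (pred_on UNIV)"
definition eL where
  "eL b h = bnum (fprod b) (inf_subsets \<times> predictors b h) (\<lambda>f (D, \<pi>). pred_on D f \<pi>)"
definition prL where
  "prL b h = dnum (fprod b) (inf_subsets \<times> predictors b h) (\<lambda>f (D, \<pi>). pred_on D f \<pi>)"
definition eI where
  "eI b h = bnum (fprod b) (predictors b h) (\<lambda>f \<pi>. \<exists>D\<in>inf_subsets. pred_on D f \<pi>)"
definition prI where
  "prI b h = dnum (fprod b) (predictors b h) (\<lambda>f \<pi>. \<exists>D\<in>inf_subsets. pred_on D f \<pi>)"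

subsection \<open>Limits over all bounds\<close>

definition minGLc where "minGLc h = card_min {bGLc b h |b. \<forall>n. h n < b n}"
definition supGLc where "supGLc h = card_sup {dGLc b h |b. \<forall>n. h n < b n}"
definition minLLc where "minLLc h = card_min {bLLc b h |b. \<forall>n. h n < b n}"
definition supLLc where "supLLc h = card_sup {dLLc b h |b. \<forall>n. h n < b n}"
definition minILc where "minILc h = card_min {bILc b h |b. \<forall>n. h n < b n}"
definition supILc where "supILc h = card_sup {dILc b h |b. \<forall>n. h n < b n}"

definition minGPr where "minGPr h = card_min {eG b h |b. \<forall>n. h n < b n}"
definition supGPr where "supGPr h = card_sup {prG b h |b. \<forall>n. h n < b n}"
definition minLPr where "minLPr h = card_min {eL b h |b. \<forall>n. h n < b n}"
definition supLPr where "supLPr h = card_sup {prL b h |b. \<forall>n. h n < b n}"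
definition minIPr where "minIPr h = card_min {eI b h |b. \<forall>n. h n < b n}"
definition supIPr where "supIPr h = card_sup {prI b h |b. \<forall>n. h n < b n}"

definition e_ubd where "e_ubd = card_min {eL b (\<lambda>_. 1) |b. \<forall>n. 2 \<le> b n}"
definition pr_ubd where "pr_ubd = card_sup {prL b (\<lambda>_. 1) |b. \<forall>n. 2 \<le> b n}"

definition to_infinity :: "(nat \<Rightarrow> nat) \<Rightarrow> bool" where
  "to_infinity h \<longleftrightarrow> filterlim h at_top sequentially"

end

theory Submission
  imports Defs "HOL-Library.Nat_Bijection"
begin

text \<open>
  Every inequality comes from a Tukey connection between a localization and a prediction system,
  with a suitably larger bound \<open>b'\<close>. A slalom is a predictor that ignores the past; conversely,
  ranging over all possible pasts turns a predictor into a slalom whose width is the number of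
  pasts times \<open>h\<close>. The width is then reduced by cutting \<open>\<omega>\<close> into blocks and coding
  \<open>x\<close> blockwise. In the global case, the blocks start where the target width is large enough.
  In the infinitely-often case, each of the finitely many candidates for a block is assigned its own
  point of the block, so width 1 suffices. In the local case, the candidates for a block form a tree
  with at most as many branches as levels; at a level without splitting the past determines the next value,
  so width 1 again suffices for prediction.
\<close>

subsection \<open>Tukey connections\<close>

text \<open>The Tukey order with the primed system on top: \<open>\<Phi>\<close> carries challenges
  up and \<open>\<Psi>\<close> brings responses back.\<close>

definition tukey ::
  "'x set \<Rightarrow> 'y set \<Rightarrow> ('x \<Rightarrow> 'y \<Rightarrow> bool) \<Rightarrow> 'v set \<Rightarrow> 'w set \<Rightarrow> ('v \<Rightarrow> 'w \<Rightarrow> bool) \<Rightarrow> bool"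
where
  "tukey X Y R X' Y' R' \<longleftrightarrow> (\<exists>\<Phi> \<Psi>. (\<forall>x\<in>X. \<Phi> x \<in> X') \<and> (\<forall>y\<in>Y'. \<Psi> y \<in> Y) \<and>
     (\<forall>x\<in>X. \<forall>y\<in>Y'. R' (\<Phi> x) y \<longrightarrow> R x (\<Psi> y)))"

lemma tukeyI:
  assumes "\<And>x. x \<in> X \<Longrightarrow> \<Phi> x \<in> X'" "\<And>y. y \<in> Y' \<Longrightarrow> \<Psi> y \<in> Y"
    and "\<And>x y. x \<in> X \<Longrightarrow> y \<in> Y' \<Longrightarrow> R' (\<Phi> x) y \<Longrightarrow> R x (\<Psi> y)"
  shows "tukey X Y R X' Y' R'"
  unfolding tukey_def using assms by blast

lemma tukey_trans:
  assumes "tukey X Y R X' Y' R'" "tukey X' Y' R' X'' Y'' R''"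
  shows "tukey X Y R X'' Y'' R''"
proof -
  obtain \<Phi> \<Psi> where 1: "\<forall>x\<in>X. \<Phi> x \<in> X'" "\<forall>y\<in>Y'. \<Psi> y \<in> Y"
    "\<forall>x\<in>X. \<forall>y\<in>Y'. R' (\<Phi> x) y \<longrightarrow> R x (\<Psi> y)"
    using assms(1) unfolding tukey_def by blast
  obtain \<Phi>' \<Psi>' where 2: "\<forall>x\<in>X'. \<Phi>' x \<in> X''" "\<forall>y\<in>Y''. \<Psi>' y \<in> Y'"
    "\<forall>x\<in>X'. \<forall>y\<in>Y''. R'' (\<Phi>' x) y \<longrightarrow> R' x (\<Psi>' y)"
    using assms(2) unfolding tukey_def by blast
  show ?thesis
  proof (rule tukeyI[of _ "\<lambda>x. \<Phi>' (\<Phi> x)" _ _ "\<lambda>y. \<Psi> (\<Psi>' y)"])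
    fix x y assume "x \<in> X" "y \<in> Y''" "R'' (\<Phi>' (\<Phi> x)) y"
    then show "R x (\<Psi> (\<Psi>' y))" using 1(1,3) 2(2,3) by simp
  qed (simp_all add: 1(1,2) 2(1,2))
qed

text \<open>Both cardinal characteristics are \<open>card_min\<close> of a nonempty set exactly for proper systems.\<close>

definition proper_system :: "'x set \<Rightarrow> 'y set \<Rightarrow> ('x \<Rightarrow> 'y \<Rightarrow> bool) \<Rightarrow> bool" where
  "proper_system X Y R \<longleftrightarrow> (\<forall>y\<in>Y. \<exists>x\<in>X. \<not> R x y) \<and> (\<forall>x\<in>X. \<exists>y\<in>Y. R x y)"

text \<open>In a proper system no \<open>y\<close> meets all of \<open>X\<close>, so
  \<open>X\<close> itself is a competitor and \<open>card_min\<close> chooses from a nonempty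
  set.\<close>

lemma bnum_least:
  assumes "proper_system X Y R"
  shows "\<exists>F\<subseteq>X. \<not> (\<exists>y\<in>Y. \<forall>x\<in>F. R x y) \<and> bnum X Y R = |F|"
    and "F \<subseteq> X \<Longrightarrow> \<not> (\<exists>y\<in>Y. \<forall>x\<in>F. R x y) \<Longrightarrow> bnum X Y R \<le>o |F|"
proof -
  define C where "C = {|F| |F. F \<subseteq> X \<and> \<not> (\<exists>y\<in>Y. \<forall>x\<in>F. R x y)}"
  have mem: "|F| \<in> C" if "F \<subseteq> X" "\<not> (\<exists>y\<in>Y. \<forall>x\<in>F. R x y)" for F
    unfolding C_def mem_Collect_eq using that by (intro exI[of _ F] conjI refl)
  have "|X| \<in> C" by (rule mem) (use assms in \<open>auto simp: proper_system_def\<close>)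
  then have ne: "C \<noteq> {}" by blast
  have co: "\<forall>r\<in>C. Card_order r" unfolding C_def using card_of_Card_order by auto
  have num: "bnum X Y R = card_min C" unfolding bnum_def C_def ..
  have "card_min C \<in> C" by (rule card_min_least(1)[OF ne co])
  then obtain G where "card_min C = |G|" "G \<subseteq> X" "\<not> (\<exists>y\<in>Y. \<forall>x\<in>G. R x y)"
    unfolding C_def mem_Collect_eq by (elim exE conjE)
  then show "\<exists>F\<subseteq>X. \<not> (\<exists>y\<in>Y. \<forall>x\<in>F. R x y) \<and> bnum X Y R = |F|"
    unfolding num by (intro exI[of _ G] conjI)
  show "bnum X Y R \<le>o |F|" if "F \<subseteq> X" "\<not> (\<exists>y\<in>Y. \<forall>x\<in>F. R x y)"
    unfolding num using card_min_least(2)[OF ne co] mem[OF that] by (rule bspec)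
qed

lemma dnum_least:
  assumes "proper_system X Y R"
  shows "\<exists>F\<subseteq>Y. (\<forall>x\<in>X. \<exists>y\<in>F. R x y) \<and> dnum X Y R = |F|"
    and "F \<subseteq> Y \<Longrightarrow> (\<forall>x\<in>X. \<exists>y\<in>F. R x y) \<Longrightarrow> dnum X Y R \<le>o |F|"
proof -
  define C where "C = {|F| |F. F \<subseteq> Y \<and> (\<forall>x\<in>X. \<exists>y\<in>F. R x y)}"
  have mem: "|F| \<in> C" if "F \<subseteq> Y" "(\<forall>x\<in>X. \<exists>y\<in>F. R x y)" for F
    unfolding C_def mem_Collect_eq using that by (intro exI[of _ F] conjI refl)
  have "|Y| \<in> C" by (rule mem) (use assms in \<open>auto simp: proper_system_def\<close>)
  then have ne: "C \<noteq> {}" by blast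
  have co: "\<forall>r\<in>C. Card_order r" unfolding C_def using card_of_Card_order by auto
  have num: "dnum X Y R = card_min C" unfolding dnum_def C_def ..
  have "card_min C \<in> C" by (rule card_min_least(1)[OF ne co])
  then obtain G where "card_min C = |G|" "G \<subseteq> Y" "(\<forall>x\<in>X. \<exists>y\<in>G. R x y)"
    unfolding C_def mem_Collect_eq by (elim exE conjE)
  then show "\<exists>F\<subseteq>Y. (\<forall>x\<in>X. \<exists>y\<in>F. R x y) \<and> dnum X Y R = |F|"
    unfolding num by (intro exI[of _ G] conjI)
  show "dnum X Y R \<le>o |F|" if "F \<subseteq> Y" "(\<forall>x\<in>X. \<exists>y\<in>F. R x y)"
    unfolding num using card_min_least(2)[OF ne co] mem[OF that] by (rule bspec)
qed

lemma Card_order_bnum: "proper_system X Y R \<Longrightarrow> Card_order (bnum X Y R)"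
  using bnum_least(1) card_of_Card_order by metis

lemma Card_order_dnum: "proper_system X Y R \<Longrightarrow> Card_order (dnum X Y R)"
  using dnum_least(1) card_of_Card_order by metis

text \<open>If some \<open>y\<close> met the whole image under \<open>\<Phi>\<close> of an unbounded
  family, then \<open>\<Psi> y\<close> would meet the family itself; so images of unbounded families
  stay unbounded.\<close>

lemma tukey_bnum:
  assumes "tukey X Y R X' Y' R'" and P: "proper_system X Y R" and P': "proper_system X' Y' R'"
  shows "bnum X' Y' R' \<le>o bnum X Y R"
proof -
  obtain \<Phi> \<Psi> where 1: "\<forall>x\<in>X. \<Phi> x \<in> X'" "\<forall>y\<in>Y'. \<Psi> y \<in> Y"
    "\<forall>x\<in>X. \<forall>y\<in>Y'. R' (\<Phi> x) y \<longrightarrow> R x (\<Psi> y)"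
    using assms(1) unfolding tukey_def by blast
  obtain F where F: "F \<subseteq> X" "\<not> (\<exists>y\<in>Y. \<forall>x\<in>F. R x y)" "bnum X Y R = |F|"
    using bnum_least(1)[OF P] by blast
  have "\<not> (\<exists>y\<in>Y'. \<forall>x\<in>\<Phi> ` F. R' x y)"
  proof
    assume "\<exists>y\<in>Y'. \<forall>x\<in>\<Phi> ` F. R' x y"
    then obtain y where y: "y \<in> Y'" "\<And>x. x \<in> F \<Longrightarrow> R' (\<Phi> x) y" by blast
    then have "\<forall>x\<in>F. R x (\<Psi> y)" using 1(3) F(1) by (simp add: subset_iff)
    then show False using F(2) 1(2) y(1) by blast
  qed
  moreover have "\<Phi> ` F \<subseteq> X'" using F(1) 1(1) by auto
  ultimately have "bnum X' Y' R' \<le>o |\<Phi> ` F|" by (intro bnum_least(2)[OF P'])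
  then show ?thesis
    unfolding F(3) by (rule ordLeq_transitive[OF _ card_of_image])
qed

lemma tukey_dnum:
  assumes "tukey X Y R X' Y' R'" and P: "proper_system X Y R" and P': "proper_system X' Y' R'"
  shows "dnum X Y R \<le>o dnum X' Y' R'"
proof -
  obtain \<Phi> \<Psi> where 1: "\<forall>x\<in>X. \<Phi> x \<in> X'" "\<forall>y\<in>Y'. \<Psi> y \<in> Y"
    "\<forall>x\<in>X. \<forall>y\<in>Y'. R' (\<Phi> x) y \<longrightarrow> R x (\<Psi> y)"
    using assms(1) unfolding tukey_def by blast
  obtain F where F: "F \<subseteq> Y'" "\<forall>x\<in>X'. \<exists>y\<in>F. R' x y" "dnum X' Y' R' = |F|"
    using dnum_least(1)[OF P'] by blast
  have "\<forall>x\<in>X. \<exists>y\<in>\<Psi> ` F. R x y"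
  proof
    fix x assume x: "x \<in> X"
    then obtain y where y: "y \<in> F" "R' (\<Phi> x) y" using F(2) 1(1) by blast
    then have "R x (\<Psi> y)" using 1(3) F(1) x by (simp add: subset_iff)
    then show "\<exists>y\<in>\<Psi> ` F. R x y" using y(1) by blast
  qed
  moreover have "\<Psi> ` F \<subseteq> Y" using F(1) 1(2) by auto
  ultimately have "dnum X Y R \<le>o |\<Psi> ` F|" by (intro dnum_least(2)[OF P])
  then show ?thesis
    unfolding F(3) by (rule ordLeq_transitive[OF _ card_of_image])
qed

text \<open>The bound \<open>b'\<close> may depend on \<open>b\<close>: the minimum is compared at a
  minimizing \<open>b\<close>, the supremum at each \<open>b\<close> separately. This lets the
  constructions below enlarge the bound freely.\<close>

lemma tukey_limits:
  assumes T: "\<And>b. P b \<Longrightarrow> \<exists>b'. P' b' \<and> tukey (fprod b) (Y b) R (fprod b') (Y' b') R'"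
    and pr: "\<And>b. P b \<Longrightarrow> proper_system (fprod b) (Y b) R"
    and pr': "\<And>b. P' b \<Longrightarrow> proper_system (fprod b) (Y' b) R'"
    and ex: "\<exists>b. P b"
  shows "card_min {bnum (fprod b) (Y' b) R' |b. P' b} \<le>o card_min {bnum (fprod b) (Y b) R |b. P b}"
    and "card_sup {dnum (fprod b) (Y b) R |b. P b} \<le>o card_sup {dnum (fprod b) (Y' b) R' |b. P' b}"
proof -
  let ?C = "{bnum (fprod b) (Y b) R |b. P b}" and ?C' = "{bnum (fprod b) (Y' b) R' |b. P' b}"
  let ?D = "{dnum (fprod b) (Y b) R |b. P b}" and ?D' = "{dnum (fprod b) (Y' b) R' |b. P' b}"
  have ne: "?C \<noteq> {}" "?C' \<noteq> {}" using ex T by blast+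
  have co: "\<forall>r\<in>?C. Card_order r" "\<forall>r\<in>?C'. Card_order r"
    "\<forall>r\<in>?D. Card_order r" "\<forall>r\<in>?D'. Card_order r"
    using pr pr' Card_order_bnum Card_order_dnum by blast+
  obtain b where b: "P b" "card_min ?C = bnum (fprod b) (Y b) R"
    using card_min_least(1)[OF ne(1) co(1)] by blast
  obtain b' where b': "P' b'" "tukey (fprod b) (Y b) R (fprod b') (Y' b') R'"
    using T[OF b(1)] by blast
  have "card_min ?C' \<le>o bnum (fprod b') (Y' b') R'"
    using card_min_least(2)[OF ne(2) co(2)] b'(1) by blast
  then show "card_min ?C' \<le>o card_min ?C"
    unfolding b(2)
    using tukey_bnum[OF b'(2) pr[OF b(1)] pr'[OF b'(1)]] ordLeq_transitive by blast
  show "card_sup ?D \<le>o card_sup ?D'"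
  proof (rule card_sup_least_upper_bound(3)[OF co(3) card_sup_least_upper_bound(1)[OF co(4)]], safe)
    fix b assume b: "P b"
    obtain b' where b': "P' b'" "tukey (fprod b) (Y b) R (fprod b') (Y' b') R'"
      using T[OF b] by blast
    have "dnum (fprod b') (Y' b') R' \<le>o card_sup ?D'"
      using card_sup_least_upper_bound(2)[OF co(4)] b'(1) by blast
    then show "dnum (fprod b) (Y b) R \<le>o card_sup ?D'"
      using tukey_dnum[OF b'(2) pr[OF b] pr'[OF b'(1)]] ordLeq_transitive by blast
  qed
qed

subsection \<open>Slaloms and predictors\<close>

text \<open>Makes every guess legal, so that the maps \<open>\<Psi>\<close> are total and a size
  estimate is due only at the points where a guess has to be right.\<close>

definition clip :: "(nat \<Rightarrow> nat) \<Rightarrow> (nat \<Rightarrow> nat) \<Rightarrow> nat set \<Rightarrow> nat \<Rightarrow> nat set" where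
  "clip b h C k = (if card (C \<inter> {..<b k}) \<le> h k then C \<inter> {..<b k} else {})"

lemma clipI:
  assumes "finite C" "card C \<le> h k" "y \<in> C" "y < b k"
  shows "y \<in> clip b h C k"
proof -
  have "card (C \<inter> {..<b k}) \<le> card C" by (rule card_mono) (use assms in auto)
  then show ?thesis using assms unfolding clip_def by auto
qed

lemma clip_slalom: "(\<lambda>k. clip b h (C k) k) \<in> slaloms b h"
  by (auto simp: slaloms_def clip_def)

lemma clip_predictor: "(\<lambda>\<sigma>\<in>Seq b. clip b h (C \<sigma>) (length \<sigma>)) \<in> predictors b h"
  by (auto simp: predictors_def clip_def)

lemma slalom_finite_card:
  assumes "\<phi> \<in> slaloms b h" shows "finite (\<phi> n)" "card (\<phi> n) \<le> h n"
  using assms finite_subset[of "\<phi> n" "{..<b n}"] by (auto simp: slaloms_def)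

lemma predictorD:
  assumes "\<pi> \<in> predictors b h" "\<sigma> \<in> Seq b"
  shows "\<pi> \<sigma> \<subseteq> {..<b (length \<sigma>)}" "finite (\<pi> \<sigma>)" "card (\<pi> \<sigma>) \<le> h (length \<sigma>)"
proof -
  show 1: "\<pi> \<sigma> \<subseteq> {..<b (length \<sigma>)}" and "card (\<pi> \<sigma>) \<le> h (length \<sigma>)"
    using PiE_mem[OF assms[unfolded predictors_def]] assms(2) by auto
  show "finite (\<pi> \<sigma>)" using 1 finite_subset by blast
qed

lemma fprod_prefix_Seq: "f \<in> fprod b \<Longrightarrow> map f [0..<n] \<in> Seq b"
  by (auto simp: fprod_def Seq_def)

text \<open>A witness \<open>D\<close> is the set of all correctly predicted points. The quantifier
  over \<open>D\<close> thus reduces to \<open>\<exists>\<^sub>\<infinity>\<close>.\<close>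

lemma predicted_infinitely_often:
  "(\<exists>D\<in>inf_subsets. pred_on D f \<pi>) \<longleftrightarrow> (\<exists>\<^sub>\<infinity>n. f n \<in> \<pi> (map f [0..<n]))"
proof
  assume "\<exists>D\<in>inf_subsets. pred_on D f \<pi>"
  then obtain D where "\<exists>\<^sub>\<infinity>n. n \<in> D" "\<forall>\<^sub>\<infinity>n. n \<in> D \<longrightarrow> f n \<in> \<pi> (map f [0..<n])"
    by (auto simp: inf_subsets_def pred_on_def INFM_iff_infinite)
  then show "\<exists>\<^sub>\<infinity>n. f n \<in> \<pi> (map f [0..<n])" by (rule frequently_rev_mp)
next
  assume "\<exists>\<^sub>\<infinity>n. f n \<in> \<pi> (map f [0..<n])"
  then show "\<exists>D\<in>inf_subsets. pred_on D f \<pi>"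
    by (intro bexI[of _ "{n. f n \<in> \<pi> (map f [0..<n])}"])
      (auto simp: inf_subsets_def pred_on_def INFM_iff_infinite)
qed

section \<open>Evasion and properness of the systems\<close>

text \<open>Diagonalization: since \<open>h n < b n\<close>, every finite sequence has a next value
  missed by \<open>\<pi>\<close>, and following these values from the empty sequence builds
  \<open>f\<close>.\<close>

lemma evading_function:
  assumes "\<pi> \<in> predictors b h" and hb: "\<forall>n. h n < b n"
  shows "\<exists>f\<in>fprod b. \<forall>n. f n \<notin> \<pi> (map f [0..<n])"
proof -
  have ex: "\<exists>y. y < b (length \<sigma>) \<and> y \<notin> \<pi> \<sigma>" if "\<sigma> \<in> Seq b" for \<sigma>
  proof (rule ccontr)
    assume "\<not> ?thesis"
    then have "{..<b (length \<sigma>)} \<subseteq> \<pi> \<sigma>" by auto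
    from card_mono[OF predictorD(2)[OF assms(1) that] this] predictorD(3)[OF assms(1) that]
    show False using hb by (metis card_lessThan leD le_trans)
  qed
  define g where "g \<sigma> = (SOME y. y < b (length \<sigma>) \<and> y \<notin> \<pi> \<sigma>)" for \<sigma>
  have g: "g \<sigma> < b (length \<sigma>) \<and> g \<sigma> \<notin> \<pi> \<sigma>" if "\<sigma> \<in> Seq b" for \<sigma>
    unfolding g_def by (rule someI_ex[OF ex[OF that]])
  define s where "s = rec_nat [] (\<lambda>_ \<sigma>. \<sigma> @ [g \<sigma>])"
  have s: "s 0 = []" "s (Suc n) = s n @ [g (s n)]" for n by (auto simp: s_def)
  have len: "length (s n) = n" for n by (induction n) (auto simp: s)
  have sq: "s n \<in> Seq b" for n
  proof (induction n)
    case (Suc n)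
    then show ?case using g[OF Suc] by (auto simp: s Seq_def nth_append len less_Suc_eq)
  qed (simp add: s Seq_def)
  have "map (\<lambda>n. g (s n)) [0..<n] = s n" for n by (induction n) (auto simp: s)
  then show ?thesis
    by (intro bexI[of _ "\<lambda>n. g (s n)"]) (use g[OF sq] in \<open>auto simp: fprod_def len\<close>)
qed

definition slalom_predictor where
  "slalom_predictor b \<phi> = (\<lambda>\<sigma>\<in>Seq b. \<phi> (length \<sigma>))"

lemma slalom_predictor:
  assumes "\<phi> \<in> slaloms b h"
  shows "slalom_predictor b \<phi> \<in> predictors b h"
  using assms by (auto simp: slaloms_def predictors_def slalom_predictor_def)

lemma slalom_predictor_prefix:
  "f \<in> fprod b \<Longrightarrow> slalom_predictor b \<phi> (map f [0..<n]) = \<phi> n"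
  by (auto simp: fprod_prefix_Seq slalom_predictor_def)

lemma pred_on_slalom_predictor:
  "f \<in> fprod b \<Longrightarrow> pred_on D f (slalom_predictor b \<phi>) \<longleftrightarrow> loc_on D f \<phi>"
  by (simp add: pred_on_def loc_on_def slalom_predictor_prefix)

lemma pred_inf_slalom_predictor:
  "f \<in> fprod b \<Longrightarrow>
    (\<exists>D\<in>inf_subsets. pred_on D f (slalom_predictor b \<phi>)) \<longleftrightarrow> loc_inf f \<phi>"
  by (simp add: predicted_infinitely_often loc_inf_def slalom_predictor_prefix)

lemma singleton_slalom:
  assumes "x \<in> fprod b" "\<forall>n. 1 \<le> h n"
  shows "(\<lambda>n. {x n}) \<in> slaloms b h"
  using assms by (auto simp: fprod_def slaloms_def)

lemma UNIV_inf_subsets: "UNIV \<in> inf_subsets"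
  by (simp add: inf_subsets_def)

text \<open>Evading a slalom reduces to evading the predictor
  \<open>slalom_predictor b \<phi>\<close>. In the other direction, \<open>1 \<le> h n\<close>
  leaves room for the slalom of singletons, which catches \<open>x\<close> everywhere.\<close>

lemma
  assumes h1: "\<forall>n. 1 \<le> h n" and hb: "\<forall>n. h n < b n"
  shows proper_GPr: "proper_system (fprod b) (predictors b h) (pred_on UNIV)"
    and proper_LPr: "proper_system (fprod b) (inf_subsets \<times> predictors b h)
      (\<lambda>f (D, \<pi>). pred_on D f \<pi>)"
    and proper_IPr: "proper_system (fprod b) (predictors b h)
      (\<lambda>f \<pi>. \<exists>D\<in>inf_subsets. pred_on D f \<pi>)"
    and proper_GLc: "proper_system (fprod b) (slaloms b h) (loc_on UNIV)"
    and proper_LLc: "proper_system (fprod b) (inf_subsets \<times> slaloms b h)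
      (\<lambda>x (D, \<phi>). loc_on D x \<phi>)"
    and proper_ILc: "proper_system (fprod b) (slaloms b h) loc_inf"
proof -
  have ev: "\<exists>f\<in>fprod b. \<forall>D\<in>inf_subsets. \<not> pred_on D f \<pi>" if pi: "\<pi> \<in> predictors b h" for \<pi>
  proof -
    obtain f where f: "f \<in> fprod b" "\<forall>n. f n \<notin> \<pi> (map f [0..<n])"
      using evading_function[OF pi hb] by (rule bexE)
    then have "\<not> (\<exists>D\<in>inf_subsets. pred_on D f \<pi>)"
      unfolding predicted_infinitely_often by simp
    then show ?thesis using f(1) by blast
  qed
  have ev': "\<exists>f\<in>fprod b. (\<forall>D\<in>inf_subsets. \<not> loc_on D f \<phi>) \<and> \<not> loc_inf f \<phi>"
    if phi: "\<phi> \<in> slaloms b h" for \<phi>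
  proof -
    obtain f where f: "f \<in> fprod b"
      "\<forall>D\<in>inf_subsets. \<not> pred_on D f (slalom_predictor b \<phi>)"
      using ev[OF slalom_predictor[OF phi]] by blast
    then show ?thesis
      using pred_on_slalom_predictor[OF f(1)] pred_inf_slalom_predictor[OF f(1)] by blast
  qed
  have loc: "\<exists>\<phi>\<in>slaloms b h. loc_on UNIV x \<phi> \<and> loc_inf x \<phi>" if "x \<in> fprod b" for x
    by (rule bexI[OF _ singleton_slalom[OF that h1]]) (simp add: loc_on_def loc_inf_def)
  have pre: "\<exists>\<pi>\<in>predictors b h. pred_on UNIV x \<pi>" if "x \<in> fprod b" for x
    using loc[OF that] slalom_predictor pred_on_slalom_predictor[OF that] by blast
  show "proper_system (fprod b) (predictors b h) (pred_on UNIV)"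
    unfolding proper_system_def using ev pre UNIV_inf_subsets by blast
  show "proper_system (fprod b) (inf_subsets \<times> predictors b h) (\<lambda>f (D, \<pi>). pred_on D f \<pi>)"
    unfolding proper_system_def using ev pre UNIV_inf_subsets by fast
  show "proper_system (fprod b) (predictors b h) (\<lambda>f \<pi>. \<exists>D\<in>inf_subsets. pred_on D f \<pi>)"
    unfolding proper_system_def using ev pre UNIV_inf_subsets by meson
  show "proper_system (fprod b) (slaloms b h) (loc_on UNIV)"
    unfolding proper_system_def using ev' loc UNIV_inf_subsets by blast
  show "proper_system (fprod b) (inf_subsets \<times> slaloms b h) (\<lambda>x (D, \<phi>). loc_on D x \<phi>)"
    unfolding proper_system_def using ev' loc UNIV_inf_subsets by fast
  show "proper_system (fprod b) (slaloms b h) loc_inf"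
    unfolding proper_system_def using ev' loc by meson
qed

lemma tukey_GPr_GLc_same:
  "tukey (fprod b) (predictors b h) (pred_on UNIV) (fprod b) (slaloms b h) (loc_on UNIV)"
  by (rule tukeyI[of _ id _ _ "slalom_predictor b"])
    (simp_all add: slalom_predictor pred_on_slalom_predictor)

lemma tukey_IPr_ILc_same:
  "tukey (fprod b) (predictors b h) (\<lambda>f \<pi>. \<exists>D\<in>inf_subsets. pred_on D f \<pi>)
     (fprod b) (slaloms b h) loc_inf"
  by (rule tukeyI[of _ id _ _ "slalom_predictor b"])
    (simp_all add: slalom_predictor pred_inf_slalom_predictor)

subsection \<open>Counting initial segments\<close>

definition nprefix :: "(nat \<Rightarrow> nat) \<Rightarrow> nat \<Rightarrow> nat" where
  "nprefix b m = card ((\<lambda>x. map x [0..<m]) ` fprod b)"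

lemma finite_segments: "finite ((\<lambda>x. map x [l..<m]) ` fprod b)"
proof (rule finite_subset)
  let ?A = "\<Union>k\<in>{l..<m}. {..<b k}"
  show "(\<lambda>x. map x [l..<m]) ` fprod b \<subseteq> {xs. set xs \<subseteq> ?A \<and> length xs = m - l}"
    by (fastforce simp: fprod_def)
  show "finite {xs. set xs \<subseteq> ?A \<and> length xs = m - l}"
    by (rule finite_lists_length_eq) simp
qed

text \<open>The first \<open>n\<close> values of \<open>\<Phi> x\<close> factor through the first
  \<open>m\<close> values of \<open>x\<close>, so codes are counted by counting segments of members
  of \<open>fprod b\<close>.\<close>

lemma image_prefixes:
  assumes "\<And>x y j. \<forall>k<m. x k = y k \<Longrightarrow> j < n \<Longrightarrow> \<Phi> x j = \<Phi> y j"
  shows "finite ((\<lambda>x. map (\<Phi> x) [0..<n]) ` fprod b)" (is "finite ?S")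
    and "card ((\<lambda>x. map (\<Phi> x) [0..<n]) ` fprod b) \<le> nprefix b m"
proof -
  \<comment> \<open>A list \<open>\<tau>\<close> of length \<open>m\<close> stands in for
    \<open>x\<close> as the sequence \<open>(!) \<tau>\<close>; its values from \<open>m\<close> on
    have no influence.\<close>
  have eq: "?S = (\<lambda>\<tau>. map (\<Phi> ((!) \<tau>)) [0..<n]) ` (\<lambda>x. map x [0..<m]) ` fprod b"
    unfolding image_image
    by (rule image_cong[OF refl], rule map_cong[OF refl], rule assms) auto
  show "finite ?S" unfolding eq by (intro finite_imageI finite_segments)
  show "card ?S \<le> nprefix b m"
    unfolding eq nprefix_def by (rule card_image_le[OF finite_segments])
qed

lemma predicted_union:
  assumes pi: "\<pi> \<in> predictors b h" and "finite S" "S \<subseteq> Seq b" "\<And>\<sigma>. \<sigma> \<in> S \<Longrightarrow> length \<sigma> = n"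
  shows "finite (\<Union>\<sigma>\<in>S. \<pi> \<sigma>)" "card (\<Union>\<sigma>\<in>S. \<pi> \<sigma>) \<le> card S * h n"
proof -
  show "finite (\<Union>\<sigma>\<in>S. \<pi> \<sigma>)" using assms predictorD(2)[OF pi] by blast
  have "card (\<Union>\<sigma>\<in>S. \<pi> \<sigma>) \<le> (\<Sum>\<sigma>\<in>S. card (\<pi> \<sigma>))" by (rule card_UN_le[OF assms(2)])
  also have "\<dots> \<le> of_nat (card S) * h n"
    by (rule sum_bounded_above) (use assms predictorD(3)[OF pi] in blast)
  finally show "card (\<Union>\<sigma>\<in>S. \<pi> \<sigma>) \<le> card S * h n" by simp
qed

text \<open>Only extensions by a predicted value are kept, so the number of pasts grows by the
  factor \<open>h n\<close> at most, however many values \<open>b n\<close> allows.\<close>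

lemma predicted_extensions:
  assumes pi: "\<pi> \<in> predictors b h" and "finite S" "S \<subseteq> Seq b" "\<And>\<sigma>. \<sigma> \<in> S \<Longrightarrow> length \<sigma> = n"
  defines "S' \<equiv> \<Union>\<sigma>\<in>S. (\<lambda>u. \<sigma> @ [u]) ` \<pi> \<sigma>"
  shows "finite S'" "card S' \<le> card S * h n" "S' \<subseteq> Seq b" "\<And>\<sigma>. \<sigma> \<in> S' \<Longrightarrow> length \<sigma> = Suc n"
proof -
  show "finite S'" unfolding S'_def using assms predictorD(2)[OF pi] by blast
  have "card S' \<le> (\<Sum>\<sigma>\<in>S. card ((\<lambda>u. \<sigma> @ [u]) ` \<pi> \<sigma>))"
    unfolding S'_def by (rule card_UN_le[OF assms(2)])
  also have "\<dots> \<le> of_nat (card S) * h n"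
  proof (rule sum_bounded_above)
    fix \<sigma> assume s: "\<sigma> \<in> S"
    then have "card ((\<lambda>u. \<sigma> @ [u]) ` \<pi> \<sigma>) \<le> card (\<pi> \<sigma>)"
      using assms(3) predictorD(2)[OF pi] card_image_le by blast
    also have "\<dots> \<le> h n" using s assms(3,4) predictorD(3)[OF pi] by blast
    finally show "card ((\<lambda>u. \<sigma> @ [u]) ` \<pi> \<sigma>) \<le> h n" .
  qed
  finally show "card S' \<le> card S * h n" by simp
  show "S' \<subseteq> Seq b"
  proof
    fix \<tau> assume "\<tau> \<in> S'"
    then obtain \<sigma> u where "\<tau> = \<sigma> @ [u]" "\<sigma> \<in> Seq b" "u \<in> \<pi> \<sigma>"
      unfolding S'_def using assms(3) by blast
    then show "\<tau> \<in> Seq b"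
      using predictorD(1)[OF pi, of \<sigma>] by (auto simp: Seq_def nth_append less_Suc_eq)
  qed
  show "\<And>\<sigma>. \<sigma> \<in> S' \<Longrightarrow> length \<sigma> = Suc n" unfolding S'_def using assms(4) by auto
qed

subsection \<open>Coding blocks\<close>

definition enc :: "(nat \<Rightarrow> nat) \<Rightarrow> (nat \<Rightarrow> nat) \<Rightarrow> nat \<Rightarrow> nat" where
  "enc i x n = list_encode (map x [i n..<i (Suc n)])"

text \<open>\<open>list_decode\<close> is total, so any number can be read as a candidate for block
  \<open>n\<close>. A list that is too short gives unspecified values, harmless because only
  \<open>enc i x n\<close> has to be decoded correctly.\<close>

definition dec :: "(nat \<Rightarrow> nat) \<Rightarrow> nat \<Rightarrow> nat \<Rightarrow> nat \<Rightarrow> nat" where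
  "dec i n v k = list_decode v ! (k - i n)"

definition blk :: "(nat \<Rightarrow> nat) \<Rightarrow> nat \<Rightarrow> nat" where
  "blk i k = (LEAST n. k < i (Suc n))"

lemma dec_enc: "i n \<le> k \<Longrightarrow> k < i (Suc n) \<Longrightarrow> dec i n (enc i x n) k = x k"
  by (simp add: dec_def enc_def)

text \<open>Members of \<open>fprod b\<close> have only finitely many restrictions to a block, so
  the codes are bounded; the bound is raised above \<open>h\<close> to be admissible in the target
  system.\<close>

lemma enc_bound:
  "\<exists>b'. (\<forall>n. h n < b' n) \<and> (\<forall>x\<in>fprod b. enc i x \<in> fprod b')"
proof -
  have "\<exists>m. h n < m \<and> (\<forall>x\<in>fprod b. enc i x n < m)" for n
  proof -
    have "finite ((\<lambda>x. enc i x n) ` fprod b)"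
      unfolding enc_def using finite_imageI[OF finite_segments, of list_encode]
      by (simp add: image_image)
    then obtain M where "\<forall>v\<in>(\<lambda>x. enc i x n) ` fprod b. v \<le> M"
      unfolding finite_nat_set_iff_bounded_le by blast
    then show ?thesis by (intro exI[of _ "Suc (M + h n)"]) fastforce
  qed
  then obtain b' where "\<forall>n. h n < b' n \<and> (\<forall>x\<in>fprod b. enc i x n < b' n)" by metis
  then show ?thesis by (intro exI[of _ b']) (auto simp: fprod_def)
qed

text \<open>Dependent choice: the right end of a block is chosen after its left end, which allows
  conditions that involve \<open>nprefix b (i n)\<close>.\<close>

lemma partition_exists:
  assumes "\<And>n l. \<exists>m>l. Q n l m"
  shows "\<exists>i. strict_mono i \<and> i 0 = (0::nat) \<and> (\<forall>n. Q n (i n) (i (Suc n)))"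
proof -
  have "\<exists>i. \<forall>n. (n = 0 \<longrightarrow> i n = 0) \<and> (i n < i (Suc n) \<and> Q n (i n) (i (Suc n)))"
    using dependent_nat_choice[of "\<lambda>n l. n = 0 \<longrightarrow> l = 0" "\<lambda>n l m. l < m \<and> Q n l m"] assms
    by auto
  then show ?thesis by (auto simp: strict_mono_Suc_iff)
qed

lemma gap_exists: "\<exists>m>l. l + c \<le> (m :: nat)"
  by (rule exI[of _ "Suc (l + c)"]) simp

lemma blk:
  assumes "strict_mono i" "i 0 = 0"
  shows "i (blk i k) \<le> k" "k < i (Suc (blk i k))"
proof -
  have "k < i (Suc k)" using strict_mono_imp_increasing[OF assms(1), of "Suc k"] by simp
  then show "k < i (Suc (blk i k))" unfolding blk_def by (rule LeastI)
  show "i (blk i k) \<le> k"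
  proof (cases "blk i k")
    case (Suc n)
    then have "n < (LEAST n. k < i (Suc n))" by (simp add: blk_def)
    from not_less_Least[OF this] show ?thesis using Suc by simp
  qed (simp add: assms)
qed

lemma blk_eq:
  assumes "strict_mono i" "i n \<le> k" "k < i (Suc n)"
  shows "blk i k = n"
  unfolding blk_def
proof (rule Least_equality)
  show "k < i (Suc n)" by fact
next
  fix m assume "k < i (Suc m)"
  then have "i n < i (Suc m)" using assms(2) by simp
  then show "n \<le> m" using strict_mono_less[OF assms(1)] by simp
qed

lemma enc_cong:
  assumes "strict_mono i" "\<forall>k<i n. x k = y k" "j < n"
  shows "enc i x j = enc i y j"
proof -
  have "i (Suc j) \<le> i n" using assms(1,3) by (simp add: strict_mono_less_eq)
  then show ?thesis unfolding enc_def using assms(2) by (intro arg_cong[of _ _ list_encode] map_cong) auto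
qed

lemma enc_prefixes:
  assumes "strict_mono i"
  shows "finite ((\<lambda>x. map (enc i x) [0..<n]) ` fprod b)"
    and "card ((\<lambda>x. map (enc i x) [0..<n]) ` fprod b) \<le> nprefix b (i n)"
  using image_prefixes[of "i n" n "enc i" b] enc_cong[OF assms] by blast+

lemma to_infinityD: "to_infinity h \<Longrightarrow> \<exists>m>l. \<forall>k\<ge>m. c \<le> h k"
  unfolding to_infinity_def filterlim_at_top eventually_sequentially
  by (metis Suc_le_lessD le_trans linorder_linear max.cobounded1 max.cobounded2)

definition block_slalom where
  "block_slalom i b h C = (\<lambda>k. clip b h ((\<lambda>v. dec i (blk i k) v k) ` C (blk i k)) k)"

text \<open>The width at \<open>k\<close> is at most the number of candidates for the block of
  \<open>k\<close>. Block 0 is among the finitely many points that may fail, so a size bound is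
  asked of \<open>C (Suc n)\<close> only.\<close>

lemma block_slalom_loc:
  assumes i: "strict_mono i" "i 0 = 0" and x: "x \<in> fprod b"
    and C: "\<And>n. finite (C n)" "\<And>n k. i (Suc n) \<le> k \<Longrightarrow> card (C (Suc n)) \<le> h k"
    and ev: "\<forall>\<^sub>\<infinity>n. enc i x n \<in> C n"
  shows "loc_on UNIV x (block_slalom i b h C)"
proof -
  obtain N where N: "\<forall>n\<ge>N. enc i x n \<in> C n" using ev unfolding MOST_nat_le by blast
  have "x k \<in> block_slalom i b h C k" if k: "i (Suc N) \<le> k" for k
  proof -
    note B = blk[OF i, of k]
    have "i (Suc N) < i (Suc (blk i k))" using k B(2) by simp
    then have "Suc N \<le> blk i k" by (simp add: strict_mono_less[OF i(1)])
    then obtain n where n: "blk i k = Suc n" "N \<le> Suc n" by (cases "blk i k") auto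
    have "x k = dec i (blk i k) (enc i x (blk i k)) k" using dec_enc B by simp
    moreover have "enc i x (blk i k) \<in> C (blk i k)" using N n by simp
    ultimately have "x k \<in> (\<lambda>v. dec i (blk i k) v k) ` C (blk i k)" by blast
    moreover have "card ((\<lambda>v. dec i (blk i k) v k) ` C (blk i k)) \<le> h k"
      using card_image_le[OF C(1)] C(2)[of n k] B(1) n le_trans by metis
    ultimately show ?thesis
      unfolding block_slalom_def using x C(1) by (intro clipI) (auto simp: fprod_def)
  qed
  then show ?thesis unfolding loc_on_def MOST_nat_le by blast
qed

section \<open>Global localization and prediction\<close>

lemma tukey_GLc_GPr:
  assumes "to_infinity h'"
  shows "\<exists>b'. (\<forall>n. h n < b' n) \<and>
    tukey (fprod b) (slaloms b h') (loc_on UNIV) (fprod b') (predictors b' h) (pred_on UNIV)"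
proof -
  \<comment> \<open>The product counts the pasts before block \<open>n\<close>, the
    \<open>h n\<close> predictions for block \<open>n\<close> after each, and the
    \<open>h (Suc n)\<close> predictions for the next block, which starts at
    \<open>i (Suc n)\<close>.\<close>
  obtain i where i: "strict_mono i" "i 0 = (0::nat)"
    and iQ: "\<forall>n. \<forall>k\<ge>i (Suc n). nprefix b (i n) * h n * h (Suc n) \<le> h' k"
    using partition_exists[of "\<lambda>n l m. \<forall>k\<ge>m. nprefix b l * h n * h (Suc n) \<le> h' k"]
      to_infinityD[OF assms] by blast
  obtain b' where b': "\<forall>n. h n < b' n" "\<forall>x\<in>fprod b. enc i x \<in> fprod b'"
    using enc_bound by blast
  define S where "S n = (\<lambda>x. map (enc i x) [0..<n]) ` fprod b" for n
  define S' where "S' \<pi> n = (\<Union>\<sigma>\<in>S n. (\<lambda>u. \<sigma> @ [u]) ` \<pi> \<sigma>)" for \<pi> :: "nat list \<Rightarrow> nat set" and n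
  \<comment> \<open>Block \<open>n + 1\<close> is guessed from the possible segments before block \<open>n\<close> by two successive
    predictions: the number of segments before block \<open>n + 1\<close> is not known when that block's
    left end, where \<open>h'\<close> must already be large, is chosen.\<close>
  define C where "C \<pi> n = (case n of 0 \<Rightarrow> {} | Suc m \<Rightarrow> (\<Union>\<sigma>\<in>S' \<pi> m. \<pi> \<sigma>))"
    for \<pi> :: "nat list \<Rightarrow> nat set" and n
  have S: "finite (S n)" "card (S n) \<le> nprefix b (i n)" "S n \<subseteq> Seq b'"
    "\<And>\<sigma>. \<sigma> \<in> S n \<Longrightarrow> length \<sigma> = n" for n
    using enc_prefixes[OF i(1)] fprod_prefix_Seq b'(2) unfolding S_def by auto
  have C: "finite (C \<pi> n)" "card (C \<pi> (Suc n)) \<le> nprefix b (i n) * h n * h (Suc n)"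
    if pi: "\<pi> \<in> predictors b' h" for \<pi> n
  proof -
    note E = predicted_extensions[OF pi S(1,3,4), folded S'_def]
    note U = predicted_union[OF pi E(1,3,4)]
    show "finite (C \<pi> n)" using U(1) by (cases n) (auto simp: C_def)
    have "card (C \<pi> (Suc n)) \<le> card (S' \<pi> n) * h (Suc n)"
      using U(2)[of n n] by (simp add: C_def)
    also have "\<dots> \<le> card (S n) * h n * h (Suc n)" using E(2)[of n n] by simp
    also have "\<dots> \<le> nprefix b (i n) * h n * h (Suc n)" using S(2) by simp
    finally show "card (C \<pi> (Suc n)) \<le> nprefix b (i n) * h n * h (Suc n)" .
  qed
  have "tukey (fprod b) (slaloms b h') (loc_on UNIV) (fprod b') (predictors b' h) (pred_on UNIV)"
  proof (rule tukeyI[of _ "enc i" _ _ "\<lambda>\<pi>. block_slalom i b h' (C \<pi>)"])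
    fix x \<pi> assume x: "x \<in> fprod b" and pi: "\<pi> \<in> predictors b' h" and "pred_on UNIV (enc i x) \<pi>"
    then obtain N where N: "\<forall>n\<ge>N. enc i x n \<in> \<pi> (map (enc i x) [0..<n])"
      unfolding pred_on_def MOST_nat_le by auto
    \<comment> \<open>From \<open>Suc N\<close> on, the predictions at \<open>n - 1\<close> and at
      \<open>n\<close> are both correct: the first puts the past of \<open>n\<close> into
      \<open>S'\<close>, the second puts the code of block \<open>n\<close> into
      \<open>C\<close>.\<close>
    have "enc i x n \<in> C \<pi> n" if n: "n \<ge> Suc N" for n
    proof -
      obtain m where m: "n = Suc m" "N \<le> m" using n by (cases n) auto
      have "map (enc i x) [0..<m] @ [enc i x m] \<in> S' \<pi> m"
        using N m(2) x unfolding S'_def S_def by blast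
      then have "map (enc i x) [0..<n] \<in> S' \<pi> m" using m by simp
      moreover have "enc i x n \<in> \<pi> (map (enc i x) [0..<n])" using N n Suc_leD by blast
      ultimately show ?thesis using m(1) by (auto simp: C_def simp del: upt_Suc)
    qed
    then have "\<forall>\<^sub>\<infinity>n. enc i x n \<in> C \<pi> n" unfolding MOST_nat_le by blast
    then show "loc_on UNIV x (block_slalom i b h' (C \<pi>))"
      by (intro block_slalom_loc[OF i x] C(1)[OF pi] order_trans[OF C(2)[OF pi]]) (use iQ in auto)
  qed (use b'(2) in \<open>auto simp: block_slalom_def clip_slalom\<close>)
  then show ?thesis using b'(1) by blast
qed

text \<open>Since \<open>h\<close> tends to infinity, block \<open>n + 1\<close> can start so late
  that \<open>h\<close> is at least \<open>h' (Suc n)\<close> from there on. A slalom of width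
  \<open>h'\<close> for the codes then yields one of width \<open>h\<close> for \<open>x\<close>,
  which serves as a predictor.\<close>

lemma tukey_GPr_GLc:
  assumes "to_infinity h"
  shows "\<exists>b'. (\<forall>n. h' n < b' n) \<and>
    tukey (fprod b) (predictors b h) (pred_on UNIV) (fprod b') (slaloms b' h') (loc_on UNIV)"
proof -
  obtain i where i: "strict_mono i" "i 0 = (0::nat)"
    and iQ: "\<forall>n. \<forall>k\<ge>i (Suc n). h' (Suc n) \<le> h k"
    using partition_exists[of "\<lambda>n l m. \<forall>k\<ge>m. h' (Suc n) \<le> h k"]
      to_infinityD[OF assms] by blast
  obtain b' where b': "\<forall>n. h' n < b' n" "\<forall>x\<in>fprod b. enc i x \<in> fprod b'"
    using enc_bound by blast
  have "tukey (fprod b) (slaloms b h) (loc_on UNIV) (fprod b') (slaloms b' h') (loc_on UNIV)"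
  proof (rule tukeyI[of _ "enc i" _ _ "block_slalom i b h"])
    fix x \<phi> assume x: "x \<in> fprod b" and p: "\<phi> \<in> slaloms b' h'" and "loc_on UNIV (enc i x) \<phi>"
    then have "\<forall>\<^sub>\<infinity>n. enc i x n \<in> \<phi> n" by (simp add: loc_on_def)
    then show "loc_on UNIV x (block_slalom i b h \<phi>)"
      by (intro block_slalom_loc[OF i x] slalom_finite_card(1)[OF p]
          order_trans[OF slalom_finite_card(2)[OF p]]) (use iQ in auto)
  qed (use b'(2) in \<open>auto simp: block_slalom_def clip_slalom\<close>)
  then show ?thesis using b'(1) tukey_trans[OF tukey_GPr_GLc_same] by blast
qed

subsection \<open>Infinitely-often localization and prediction\<close>

text \<open>If a block has at least as many points as there are candidates for the restriction of
  \<open>x\<close> to it, then singletons suffice to catch \<open>x\<close> once: assign to each candidate its own point.\<close>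

lemma point_slalom_exists:
  assumes i: "strict_mono i" and h1: "\<forall>n. 1 \<le> h n"
    and C: "\<And>n. finite (C n)" "\<And>n. i n + card (C n) \<le> i (Suc n)"
  shows "\<exists>\<phi>\<in>slaloms b h. \<forall>x\<in>fprod b. (\<exists>\<^sub>\<infinity>n. enc i x n \<in> C n) \<longrightarrow> loc_inf x \<phi>"
proof -
  have "\<exists>g. g ` C n \<subseteq> {i n..<i (Suc n)} \<and> inj_on g (C n)" for n
    using C(1,2)[of n] by (intro card_le_inj) (auto simp: le_diff_conv2)
  then obtain g where g: "\<And>n. g n ` C n \<subseteq> {i n..<i (Suc n)}" "\<And>n. inj_on (g n) (C n)" by metis
  \<comment> \<open>Injectivity of \<open>g\<close> on the candidates leaves at most one of them
    responsible for \<open>k\<close>, so the slalom has at most one element at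
    \<open>k\<close>.\<close>
  define A where "A k = {v \<in> C (blk i k). g (blk i k) v = k}" for k
  define \<phi> where "\<phi> k = clip b h ((\<lambda>v. dec i (blk i k) v k) ` A k) k" for k
  have A: "finite (A k)" "card (A k) \<le> 1" for k
  proof -
    show fin: "finite (A k)" using C(1) unfolding A_def by simp
    have "\<forall>v\<in>A k. \<forall>w\<in>A k. v = w"
      using g(2)[of "blk i k"] unfolding A_def by (auto simp: inj_on_def)
    then show "card (A k) \<le> 1" by (simp add: card_le_Suc0_iff_eq[OF fin])
  qed
  have "loc_inf x \<phi>" if x: "x \<in> fprod b" and inf: "\<exists>\<^sub>\<infinity>n. enc i x n \<in> C n" for x
    unfolding loc_inf_def INFM_nat_le
  proof
    fix m
    obtain n where n: "m \<le> n" "enc i x n \<in> C n" using inf unfolding INFM_nat_le by blast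
    define k where "k = g n (enc i x n)"
    have k: "i n \<le> k" "k < i (Suc n)" using g(1)[of n] n(2) unfolding k_def by auto
    note B = blk_eq[OF i k]
    have "card ((\<lambda>v. dec i (blk i k) v k) ` A k) \<le> h k"
      using card_image_le[OF A(1)] A(2) h1 le_trans by metis
    moreover have "enc i x n \<in> A k" using n(2) B by (simp add: A_def k_def)
    then have "x k \<in> (\<lambda>v. dec i (blk i k) v k) ` A k"
      using dec_enc[of i n k x, OF k] unfolding B by force
    ultimately have "x k \<in> \<phi> k"
      unfolding \<phi>_def using x A(1) by (intro clipI) (auto simp: fprod_def)
    moreover have "m \<le> k" using n(1) k(1) strict_mono_imp_increasing[OF i, of n] by simp
    ultimately show "\<exists>n\<ge>m. x n \<in> \<phi> n" by blast
  qed
  moreover have "\<phi> \<in> slaloms b h" using clip_slalom unfolding \<phi>_def .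
  ultimately show ?thesis by blast
qed

lemma tukey_ILcI:
  assumes i: "strict_mono i" and h1: "\<forall>n. 1 \<le> h n"
    and C: "\<And>y n. y \<in> Y \<Longrightarrow> finite (C y n)" "\<And>y n. y \<in> Y \<Longrightarrow> i n + card (C y n) \<le> i (Suc n)"
    and X: "\<And>x. x \<in> fprod b \<Longrightarrow> enc i x \<in> X"
    and R: "\<And>x y. x \<in> fprod b \<Longrightarrow> y \<in> Y \<Longrightarrow> R (enc i x) y \<Longrightarrow> \<exists>\<^sub>\<infinity>n. enc i x n \<in> C y n"
  shows "tukey (fprod b) (slaloms b h) loc_inf X Y R"
proof -
  have "\<forall>y\<in>Y. \<exists>\<phi>\<in>slaloms b h. \<forall>x\<in>fprod b. (\<exists>\<^sub>\<infinity>n. enc i x n \<in> C y n) \<longrightarrow> loc_inf x \<phi>"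
    using point_slalom_exists[OF i h1, of "C _"] C by blast
  then obtain \<Psi> where "\<forall>y\<in>Y. \<Psi> y \<in> slaloms b h \<and>
      (\<forall>x\<in>fprod b. (\<exists>\<^sub>\<infinity>n. enc i x n \<in> C y n) \<longrightarrow> loc_inf x (\<Psi> y))" by metis
  then show ?thesis using X R by (intro tukeyI[of _ "enc i" _ _ \<Psi>]) auto
qed

lemma tukey_ILc_IPr:
  assumes h1: "\<forall>n. 1 \<le> h' n"
  shows "\<exists>b'. (\<forall>n. h n < b' n) \<and> tukey (fprod b) (slaloms b h') loc_inf
    (fprod b') (predictors b' h) (\<lambda>f \<pi>. \<exists>D\<in>inf_subsets. pred_on D f \<pi>)"
proof -
  \<comment> \<open>The pasts before block \<open>n\<close> are counted from its left end, and only
    the right end has to be far away; so, unlike in the global case, a single prediction is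
    enough.\<close>
  obtain i where i: "strict_mono i" "i 0 = (0::nat)"
    and iQ: "\<forall>n. i n + nprefix b (i n) * h n \<le> i (Suc n)"
    using partition_exists[of "\<lambda>n l m. l + nprefix b l * h n \<le> m"] gap_exists by blast
  obtain b' where b': "\<forall>n. h n < b' n" "\<forall>x\<in>fprod b. enc i x \<in> fprod b'"
    using enc_bound by blast
  define S where "S n = (\<lambda>x. map (enc i x) [0..<n]) ` fprod b" for n
  have S: "finite (S n)" "card (S n) \<le> nprefix b (i n)" "S n \<subseteq> Seq b'"
    "\<And>\<sigma>. \<sigma> \<in> S n \<Longrightarrow> length \<sigma> = n" for n
    using enc_prefixes[OF i(1)] fprod_prefix_Seq b'(2) unfolding S_def by auto
  have "tukey (fprod b) (slaloms b h') loc_inf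
    (fprod b') (predictors b' h) (\<lambda>f \<pi>. \<exists>D\<in>inf_subsets. pred_on D f \<pi>)"
  proof (rule tukey_ILcI[OF i(1) h1, where C = "\<lambda>\<pi> n. \<Union>\<sigma>\<in>S n. \<pi> \<sigma>"])
    fix \<pi> n assume pi: "\<pi> \<in> predictors b' h"
    note U = predicted_union[OF pi S(1,3,4)]
    show "finite (\<Union>\<sigma>\<in>S n. \<pi> \<sigma>)" by (rule U(1))
    have "card (\<Union>\<sigma>\<in>S n. \<pi> \<sigma>) \<le> card (S n) * h n" by (rule U(2))
    also have "\<dots> \<le> nprefix b (i n) * h n" using S(2) by simp
    finally show "i n + card (\<Union>\<sigma>\<in>S n. \<pi> \<sigma>) \<le> i (Suc n)" using iQ[rule_format, of n] by simp
  next
    fix x \<pi> assume x: "x \<in> fprod b" "\<exists>D\<in>inf_subsets. pred_on D (enc i x) \<pi>"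
    then have "\<exists>\<^sub>\<infinity>n. enc i x n \<in> \<pi> (map (enc i x) [0..<n])"
      unfolding predicted_infinitely_often by simp
    then show "\<exists>\<^sub>\<infinity>n. enc i x n \<in> (\<Union>\<sigma>\<in>S n. \<pi> \<sigma>)"
      by (rule frequently_elim1) (use x(1) S_def in blast)
  qed (use b'(2) in auto)
  then show ?thesis using b'(1) by blast
qed

text \<open>The slalom itself offers at most \<open>h' n\<close> codes for block \<open>n\<close>,
  so a block of length at least \<open>h' n\<close> has a point for each.\<close>

lemma tukey_IPr_ILc:
  assumes h1: "\<forall>n. 1 \<le> h n"
  shows "\<exists>b'. (\<forall>n. h' n < b' n) \<and> tukey (fprod b) (predictors b h)
    (\<lambda>f \<pi>. \<exists>D\<in>inf_subsets. pred_on D f \<pi>) (fprod b') (slaloms b' h') loc_inf"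
proof -
  obtain i where i: "strict_mono i" "i 0 = (0::nat)" and iQ: "\<forall>n. i n + h' n \<le> i (Suc n)"
    using partition_exists[of "\<lambda>n l m. l + h' n \<le> m"] gap_exists by blast
  obtain b' where b': "\<forall>n. h' n < b' n" "\<forall>x\<in>fprod b. enc i x \<in> fprod b'"
    using enc_bound by blast
  have "tukey (fprod b) (slaloms b h) loc_inf (fprod b') (slaloms b' h') loc_inf"
  proof (rule tukey_ILcI[OF i(1) h1, where C = "\<lambda>\<phi>. \<phi>"])
    fix \<phi> n assume "\<phi> \<in> slaloms b' h'"
    from slalom_finite_card[OF this, of n] iQ[rule_format, of n]
    show "finite (\<phi> n)" "i n + card (\<phi> n) \<le> i (Suc n)" by auto
  qed (use b'(2) in \<open>auto simp: loc_inf_def\<close>)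
  then show ?thesis using b'(1) tukey_trans[OF tukey_IPr_ILc_same] by blast
qed

subsection \<open>Local prediction\<close>

lemma tukey_LLc_LPr:
  assumes "to_infinity h'"
  shows "\<exists>b'. (\<forall>n. h n < b' n) \<and>
    tukey (fprod b) (inf_subsets \<times> slaloms b h') (\<lambda>x (D, \<phi>). loc_on D x \<phi>)
      (fprod b') (inf_subsets \<times> predictors b' h) (\<lambda>f (D, \<pi>). pred_on D f \<pi>)"
proof -
  \<comment> \<open>A sparse subsequence of \<open>x\<close> is predicted; the skipped values need not be localized.\<close>
  obtain k where k: "strict_mono k"
    and kQ: "\<forall>n. nprefix b (Suc (k n)) * h (Suc n) \<le> h' (k (Suc n))"
    using partition_exists[of "\<lambda>n l m. nprefix b (Suc l) * h (Suc n) \<le> h' m"]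
      to_infinityD[OF assms] by (meson order_refl)
  have inj: "inj k" using k by (rule strict_mono_imp_inj_on)
  define b' where "b' n = Suc (b (k n) + h n)" for n
  have b': "x \<circ> k \<in> fprod b'" if "x \<in> fprod b" for x
    using that by (auto simp: fprod_def b'_def intro: less_SucI trans_less_add1)
  define S where "S n = (\<lambda>x. map (x \<circ> k) [0..<n]) ` fprod b" for n
  have S: "finite (S (Suc n))" "card (S (Suc n)) \<le> nprefix b (Suc (k n))" "S n \<subseteq> Seq b'"
    "\<And>\<sigma>. \<sigma> \<in> S n \<Longrightarrow> length \<sigma> = n" for n
  proof -
    \<comment> \<open>The first \<open>Suc n\<close> values of \<open>x \<circ> k\<close> depend
      only on \<open>x\<close> below \<open>Suc (k n)\<close>; this is the source of the factor
      \<open>nprefix b (Suc (k n))\<close> in \<open>kQ\<close>.\<close>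
    have "(x \<circ> k) j = (y \<circ> k) j" if "\<forall>l<Suc (k n). x l = y l" "j < Suc n" for x y :: "nat \<Rightarrow> nat" and j
      using that k by (simp add: less_Suc_eq_le strict_mono_less_eq)
    from image_prefixes[of "Suc (k n)" "Suc n" "\<lambda>x. x \<circ> k", OF this]
    show "finite (S (Suc n))" "card (S (Suc n)) \<le> nprefix b (Suc (k n))"
      unfolding S_def by blast+
  qed (use fprod_prefix_Seq b' S_def in auto)
  \<comment> \<open>\<open>inv k\<close> recovers the index in the subsequence. Off the range of
    \<open>k\<close> the slalom may be anything, since localization is claimed only on the image of
    \<open>D\<close>.\<close>
  define \<Psi> where "\<Psi> \<pi> j = clip b h' (\<Union>\<sigma>\<in>S (inv k j). \<pi> \<sigma>) j"
    for \<pi> :: "nat list \<Rightarrow> nat set" and j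
  have "tukey (fprod b) (inf_subsets \<times> slaloms b h') (\<lambda>x (D, \<phi>). loc_on D x \<phi>)
      (fprod b') (inf_subsets \<times> predictors b' h) (\<lambda>f (D, \<pi>). pred_on D f \<pi>)"
  proof (rule tukeyI[of _ "\<lambda>x. x \<circ> k" _ _ "\<lambda>(D, \<pi>). (k ` D, \<Psi> \<pi>)"])
    fix y assume "y \<in> inf_subsets \<times> predictors b' h"
    then obtain D \<pi> where Y: "y = (D, \<pi>)" "infinite D" unfolding inf_subsets_def by blast
    have "infinite (k ` D)" using Y(2) finite_image_iff[OF inj_on_subset[OF inj subset_UNIV]] by simp
    moreover have "\<Psi> \<pi> \<in> slaloms b h'" unfolding \<Psi>_def by (rule clip_slalom)
    ultimately show "(case y of (D, \<pi>) \<Rightarrow> (k ` D, \<Psi> \<pi>)) \<in> inf_subsets \<times> slaloms b h'"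
      by (simp add: Y(1) inf_subsets_def)
  next
    fix x y assume x: "x \<in> fprod b" and y: "y \<in> inf_subsets \<times> predictors b' h"
      and R: "case y of (D, \<pi>) \<Rightarrow> pred_on D (x \<circ> k) \<pi>"
    obtain D \<pi> where Y: "y = (D, \<pi>)" and pi: "\<pi> \<in> predictors b' h" using y by blast
    obtain N where N: "\<forall>n\<ge>N. n \<in> D \<longrightarrow> x (k n) \<in> \<pi> (map (x \<circ> k) [0..<n])"
      using R unfolding Y pred_on_def MOST_nat_le by auto
    have "x j \<in> \<Psi> \<pi> j" if j: "j \<ge> k (Suc N)" "j \<in> k ` D" for j
    proof -
      obtain n where n: "j = k n" "n \<in> D" using j(2) by blast
      \<comment> \<open>The index must be a successor, because \<open>kQ\<close> bounds the width at
        \<open>k (Suc n)\<close> only.\<close>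
      then have "Suc N \<le> n" using j(1) k by (simp add: strict_mono_less_eq)
      then obtain m where m: "n = Suc m" "N \<le> n" by (cases n) auto
      note U = predicted_union[OF pi S(1,3,4), of m]
      have "inv k j = Suc m" using n m inj by simp
      moreover have "x j \<in> (\<Union>\<sigma>\<in>S (Suc m). \<pi> \<sigma>)"
        using N n m x unfolding S_def by blast
      moreover have "card (\<Union>\<sigma>\<in>S (Suc m). \<pi> \<sigma>) \<le> h' j"
      proof -
        have "card (\<Union>\<sigma>\<in>S (Suc m). \<pi> \<sigma>) \<le> card (S (Suc m)) * h (Suc m)" by (rule U(2))
        also have "\<dots> \<le> nprefix b (Suc (k m)) * h (Suc m)" using S(2) by simp
        also have "\<dots> \<le> h' j" using kQ n m by simp
        finally show ?thesis .
      qed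
      ultimately show ?thesis
        unfolding \<Psi>_def using U(1) x by (intro clipI) (auto simp: fprod_def)
    qed
    then show "case (case y of (D, \<pi>) \<Rightarrow> (k ` D, \<Psi> \<pi>)) of (D, \<phi>) \<Rightarrow> loc_on D x \<phi>"
      unfolding Y loc_on_def MOST_nat_le by auto
  qed (rule b')
  then show ?thesis by (intro exI[of _ b']) (auto simp: b'_def)
qed

text \<open>Each level at which some node splits adds a node, so a tree with at most \<open>m\<close> branches
  does not split at some level below \<open>m\<close>.\<close>

lemma nonsplitting_level:
  fixes s :: "'a \<Rightarrow> nat \<Rightarrow> 'b"
  assumes "finite A" "card A \<le> m" "0 < m"
  shows "\<exists>j<m. \<forall>v\<in>A. \<forall>w\<in>A. (\<forall>l<j. s v l = s w l) \<longrightarrow> s v j = s w j"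
proof (rule ccontr)
  assume neg: "\<not> ?thesis"
  define T where "T j = (\<lambda>v. map (s v) [0..<j]) ` A" for j
  have "Suc j \<le> card (T j)" if "j \<le> m" for j
    using that
  proof (induction j)
    case 0
    have "A \<noteq> {}" using neg assms(3) by blast
    then show ?case using assms(1) by (simp add: T_def image_constant_conv)
  next
    case (Suc j)
    have fin: "finite (T (Suc j))" using assms(1) by (simp add: T_def)
    have eq: "T j = take j ` T (Suc j)"
      unfolding T_def image_image by (rule image_cong) (auto simp: take_map)
    obtain v w where vw: "v \<in> A" "w \<in> A" "\<forall>l<j. s v l = s w l" "s v j \<noteq> s w j"
      using neg Suc.prems by (meson Suc_le_lessD)
    \<comment> \<open>A split at level \<open>j\<close> gives two nodes of level
      \<open>j + 1\<close> with the same truncation, so truncation strictly lowers the number of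
      nodes.\<close>
    have "\<not> inj_on (take j) (T (Suc j))"
    proof
      assume "inj_on (take j) (T (Suc j))"
      then have "map (s v) [0..<Suc j] = map (s w) [0..<Suc j]"
        by (rule inj_onD) (use vw in \<open>auto simp: T_def take_map\<close>)
      then show False using vw(4) by simp
    qed
    then have "card (T j) \<noteq> card (T (Suc j))"
      unfolding eq using eq_card_imp_inj_on[OF fin] by metis
    moreover have "card (T j) \<le> card (T (Suc j))" unfolding eq by (rule card_image_le[OF fin])
    ultimately show ?case using Suc by simp
  qed
  from this[of m] have "Suc m \<le> card (T m)" by simp
  also have "\<dots> \<le> card A" unfolding T_def by (rule card_image_le[OF assms(1)])
  finally show False using assms(2) by simp
qed

text \<open>A block at least as long as the slalom is wide has a nonsplitting level. One such point
  from each block with index in \<open>D\<close> gives the new infinite set, and there the past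
  inside the block leaves a single guess.\<close>

lemma tukey_LPr_LLc:
  assumes h1: "\<forall>n. 1 \<le> h n"
  shows "\<exists>b'. (\<forall>n. h' n < b' n) \<and>
    tukey (fprod b) (inf_subsets \<times> predictors b h) (\<lambda>f (D, \<pi>). pred_on D f \<pi>)
      (fprod b') (inf_subsets \<times> slaloms b' h') (\<lambda>x (D, \<phi>). loc_on D x \<phi>)"
proof -
  obtain i where i: "strict_mono i" "i 0 = (0::nat)" and iQ: "\<forall>n. i n + h' n \<le> i (Suc n)"
    using partition_exists[of "\<lambda>n l m. l + h' n \<le> m"] gap_exists by blast
  obtain b' where b': "\<forall>n. h' n < b' n" "\<forall>x\<in>fprod b. enc i x \<in> fprod b'"
    using enc_bound by blast
  \<comment> \<open>Expresses that \<open>k\<close> is a nonsplitting level of the tree of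
    candidates for block \<open>n\<close>.\<close>
  define uniform where "uniform \<phi> n k \<longleftrightarrow> i n \<le> k \<and> k < i (Suc n) \<and>
      (\<forall>v\<in>\<phi> n. \<forall>w\<in>\<phi> n. (\<forall>l\<in>{i n..<k}. dec i n v l = dec i n w l) \<longrightarrow> dec i n v k = dec i n w k)"
    for \<phi> :: "nat \<Rightarrow> nat set" and n k
  have "\<exists>k. uniform \<phi> n k" if phi: "\<phi> \<in> slaloms b' h'" for \<phi> n
  proof -
    have "card (\<phi> n) \<le> i (Suc n) - i n"
      using slalom_finite_card(2)[OF phi, of n] iQ[rule_format, of n] by simp
    moreover have "0 < i (Suc n) - i n" using i(1) by (simp add: strict_mono_less)
    ultimately obtain j where j: "j < i (Suc n) - i n"
      "\<forall>v\<in>\<phi> n. \<forall>w\<in>\<phi> n. (\<forall>l<j. dec i n v (i n + l) = dec i n w (i n + l)) \<longrightarrow>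
        dec i n v (i n + j) = dec i n w (i n + j)"
      using nonsplitting_level[OF slalom_finite_card(1)[OF phi],
          where s = "\<lambda>v l. dec i n v (i n + l)"] by blast
    have "uniform \<phi> n (i n + j)"
      unfolding uniform_def
    proof (intro conjI ballI impI)
      fix v w assume vw: "v \<in> \<phi> n" "w \<in> \<phi> n"
        and "\<forall>l\<in>{i n..<i n + j}. dec i n v l = dec i n w l"
      then have "dec i n v (i n + l) = dec i n w (i n + l)" if "l < j" for l using that by simp
      then show "dec i n v (i n + j) = dec i n w (i n + j)" using j(2)[rule_format, OF vw] by blast
    qed (use j(1) in auto)
    then show ?thesis by blast
  qed
  then obtain K where K: "\<And>\<phi> n. \<phi> \<in> slaloms b' h' \<Longrightarrow> uniform \<phi> n (K \<phi> n)" by metis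
  \<comment> \<open>The past selects those candidates that agree with it since the start of the
    block. At the points \<open>K \<phi> n\<close> they leave one guess; elsewhere
    \<open>clip\<close> may discard the result.\<close>
  define G where "G \<phi> \<sigma> = (let k = length \<sigma>; n = blk i k in
      (\<lambda>v. dec i n v k) ` {v \<in> \<phi> n. \<forall>l\<in>{i n..<k}. dec i n v l = \<sigma> ! l})"
    for \<phi> :: "nat \<Rightarrow> nat set" and \<sigma>
  define \<Psi> where "\<Psi> \<phi> = (\<lambda>\<sigma>\<in>Seq b. clip b h (G \<phi> \<sigma>) (length \<sigma>))" for \<phi>
  have "tukey (fprod b) (inf_subsets \<times> predictors b h) (\<lambda>f (D, \<pi>). pred_on D f \<pi>)
      (fprod b') (inf_subsets \<times> slaloms b' h') (\<lambda>x (D, \<phi>). loc_on D x \<phi>)"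
  proof (rule tukeyI[of _ "enc i" _ _ "\<lambda>(D, \<phi>). (K \<phi> ` D, \<Psi> \<phi>)"])
    fix y assume "y \<in> inf_subsets \<times> slaloms b' h'"
    then obtain D \<phi> where Y: "y = (D, \<phi>)" "infinite D" "\<phi> \<in> slaloms b' h'"
      unfolding inf_subsets_def by blast
    have "inj (K \<phi>)"
      by (rule inj_on_inverseI[of _ "blk i"])
        (use K[OF Y(3)] blk_eq[OF i(1)] in \<open>auto simp: uniform_def\<close>)
    then have "infinite (K \<phi> ` D)"
      using Y(2) finite_imageD inj_on_subset[OF _ subset_UNIV] by blast
    then show "(case y of (D, \<phi>) \<Rightarrow> (K \<phi> ` D, \<Psi> \<phi>)) \<in> inf_subsets \<times> predictors b h"
      using clip_predictor unfolding Y(1) inf_subsets_def \<Psi>_def by simp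
  next
    fix x y assume x: "x \<in> fprod b" and y: "y \<in> inf_subsets \<times> slaloms b' h'"
      and R: "case y of (D, \<phi>) \<Rightarrow> loc_on D (enc i x) \<phi>"
    obtain D \<phi> where Y: "y = (D, \<phi>)" and p: "\<phi> \<in> slaloms b' h'" using y by blast
    obtain N where N: "\<forall>n\<ge>N. n \<in> D \<longrightarrow> enc i x n \<in> \<phi> n"
      using R unfolding Y loc_on_def MOST_nat_le by auto
    have "x k \<in> \<Psi> \<phi> (map x [0..<k])" if k: "k \<ge> i N" "k \<in> K \<phi> ` D" for k
    proof -
      obtain n where n: "k = K \<phi> n" "n \<in> D" using k(2) by blast
      have "uniform \<phi> n k" unfolding n(1) by (rule K[OF p])
      then have u: "i n \<le> k" "k < i (Suc n)"
        "\<forall>v\<in>\<phi> n. \<forall>w\<in>\<phi> n. (\<forall>l\<in>{i n..<k}. dec i n v l = dec i n w l) \<longrightarrow> dec i n v k = dec i n w k"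
        unfolding uniform_def by iprover+
      note B = blk_eq[OF i(1) u(1,2)]
      have "i N < i (Suc n)" using k(1) u(2) by simp
      then have "N \<le> n" by (simp add: strict_mono_less[OF i(1)])
      then have mem: "enc i x n \<in> \<phi> n" using N n(2) by blast
      let ?V = "{v \<in> \<phi> n. \<forall>l\<in>{i n..<k}. dec i n v l = x l}"
      have G: "G \<phi> (map x [0..<k]) = (\<lambda>v. dec i n v k) ` ?V"
      proof -
        have "?V = {v \<in> \<phi> n. \<forall>l\<in>{i n..<k}. dec i n v l = map x [0..<k] ! l}" by auto
        then show ?thesis unfolding G_def Let_def by (simp add: B)
      qed
      have "enc i x n \<in> ?V" using mem u(2) by (auto simp: dec_enc)
      then have xk: "x k \<in> G \<phi> (map x [0..<k])"
        unfolding G using dec_enc[of i n k x, OF u(1,2)] by (metis (no_types, lifting) imageI)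
      have fin: "finite (G \<phi> (map x [0..<k]))"
        unfolding G using slalom_finite_card(1)[OF p] by simp
      \<comment> \<open>Candidates that agree with \<open>x\<close> before \<open>k\<close> agree
        with each other there, so the choice of \<open>k\<close> forces the same value at
        \<open>k\<close>.\<close>
      have "dec i n v k = dec i n w k" if "v \<in> ?V" "w \<in> ?V" for v w
        using that by (intro u(3)[rule_format]) simp_all
      then have "\<forall>a\<in>G \<phi> (map x [0..<k]). \<forall>c\<in>G \<phi> (map x [0..<k]). a = c"
        unfolding G by blast
      then have "card (G \<phi> (map x [0..<k])) \<le> h k"
        using card_le_Suc0_iff_eq[OF fin] h1[rule_format, of k] by linarith
      from clipI[OF fin, of h k, OF this xk, of b] show ?thesis
        using x fprod_prefix_Seq[OF x, of k] unfolding \<Psi>_def by (simp add: fprod_def)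
    qed
    then show "case (case y of (D, \<phi>) \<Rightarrow> (K \<phi> ` D, \<Psi> \<phi>)) of (D, \<pi>) \<Rightarrow> pred_on D x \<pi>"
      unfolding Y pred_on_def MOST_nat_le by auto
  qed (use b'(2) in auto)
  then show ?thesis using b'(1) by blast
qed

subsection \<open>Comparison of the limits\<close>

lemma ex_above: "\<exists>b. \<forall>n. (h :: nat \<Rightarrow> nat) n < b n"
  by (rule exI[of _ "\<lambda>n. Suc (h n)"]) simp

lemma GPr_le_GLc:
  assumes "\<forall>n. 1 \<le> h n" "\<forall>n. 1 \<le> h' n" "to_infinity h'"
  shows "minGPr h \<le>o minGLc h'" "supGLc h' \<le>o supGPr h"
  unfolding minGPr_def minGLc_def supGPr_def supGLc_def eG_def prG_def bGLc_def dGLc_def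
  by (rule tukey_limits[OF tukey_GLc_GPr proper_GLc proper_GPr ex_above]; use assms in blast)+

lemma GLc_le_GPr:
  assumes "\<forall>n. 1 \<le> h n" "\<forall>n. 1 \<le> h' n" "to_infinity h"
  shows "minGLc h' \<le>o minGPr h" "supGPr h \<le>o supGLc h'"
  unfolding minGPr_def minGLc_def supGPr_def supGLc_def eG_def prG_def bGLc_def dGLc_def
  by (rule tukey_limits[OF tukey_GPr_GLc proper_GPr proper_GLc ex_above]; use assms in blast)+

lemma LPr_eq_LLc:
  assumes "\<forall>n. 1 \<le> h n" "\<forall>n. 1 \<le> h' n" "to_infinity h'"
  shows "minLPr h =o minLLc h'" "supLPr h =o supLLc h'"
proof -
  have "minLPr h \<le>o minLLc h'" "supLLc h' \<le>o supLPr h"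
    unfolding minLPr_def minLLc_def supLPr_def supLLc_def eL_def prL_def bLLc_def dLLc_def
    by (rule tukey_limits[OF tukey_LLc_LPr proper_LLc proper_LPr ex_above]; use assms in blast)+
  moreover have "minLLc h' \<le>o minLPr h" "supLPr h \<le>o supLLc h'"
    unfolding minLPr_def minLLc_def supLPr_def supLLc_def eL_def prL_def bLLc_def dLLc_def
    by (rule tukey_limits[OF tukey_LPr_LLc proper_LPr proper_LLc ex_above]; use assms in blast)+
  ultimately show "minLPr h =o minLLc h'" "supLPr h =o supLLc h'"
    by (auto simp: ordIso_iff_ordLeq)
qed

lemma IPr_eq_ILc:
  assumes "\<forall>n. 1 \<le> h n" "\<forall>n. 1 \<le> h' n"
  shows "minIPr h =o minILc h'" "supIPr h =o supILc h'"
proof -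
  have "minIPr h \<le>o minILc h'" "supILc h' \<le>o supIPr h"
    unfolding minIPr_def minILc_def supIPr_def supILc_def eI_def prI_def bILc_def dILc_def
    by (rule tukey_limits[OF tukey_ILc_IPr proper_ILc proper_IPr ex_above]; use assms in blast)+
  moreover have "minILc h' \<le>o minIPr h" "supIPr h \<le>o supILc h'"
    unfolding minIPr_def minILc_def supIPr_def supILc_def eI_def prI_def bILc_def dILc_def
    by (rule tukey_limits[OF tukey_IPr_ILc proper_IPr proper_ILc ex_above]; use assms in blast)+
  ultimately show "minIPr h =o minILc h'" "supIPr h =o supILc h'"
    by (auto simp: ordIso_iff_ordLeq)
qed

text \<open>For natural numbers \<open>1 < b n\<close> amounts to \<open>2 \<le> b n\<close>, so
  both limits range over the same bounds.\<close>

lemma ubd_eq_LPr_one: "e_ubd = minLPr (\<lambda>_. 1)" "pr_ubd = supLPr (\<lambda>_. 1)"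
  by (simp_all add: e_ubd_def pr_ubd_def minLPr_def supLPr_def Suc_le_eq numeral_2_eq_2)

text \<open>A common value such as \<open>minGLc\<close> is represented by \<open>minGLc h'\<close>
  for an arbitrary admissible width \<open>h'\<close>.\<close>

theorem theorem4p4:
  fixes h :: "nat \<Rightarrow> nat"
  assumes "\<forall>n. 1 \<le> h n"
  shows
    "(\<forall>h'. (\<forall>n. 1 \<le> h' n) \<and> to_infinity h' \<longrightarrow>
        minGPr h \<le>o minGLc h' \<and> supGLc h' \<le>o supGPr h \<and>
        (to_infinity h \<longrightarrow> minGPr h =o minGLc h' \<and> supGPr h =o supGLc h'))
   \<and> (\<forall>h'. (\<forall>n. 1 \<le> h' n) \<and> to_infinity h' \<longrightarrow>
        e_ubd =o minLPr h \<and> minLPr h =o minLLc h' \<and>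
        pr_ubd =o supLPr h \<and> supLPr h =o supLLc h')
   \<and> (\<forall>h'. (\<forall>n. 1 \<le> h' n) \<longrightarrow>
        minIPr h =o minILc h' \<and> supIPr h =o supILc h')"
proof (intro conjI allI impI; (elim conjE)?)
  fix h' :: "nat \<Rightarrow> nat" assume h': "\<forall>n. 1 \<le> h' n" "to_infinity h'"
  show G: "minGPr h \<le>o minGLc h'" "supGLc h' \<le>o supGPr h"
    using GPr_le_GLc[OF assms h'] by auto
  show "minGPr h =o minGLc h'" "supGPr h =o supGLc h'" if "to_infinity h"
    using G GLc_le_GPr[OF assms h'(1) that] by (auto simp: ordIso_iff_ordLeq)
  show L: "minLPr h =o minLLc h'" "supLPr h =o supLLc h'"
    using LPr_eq_LLc[OF assms h'] by auto
  \<comment> \<open>\<open>e_ubd\<close> and \<open>pr_ubd\<close> are the case of width 1.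
    Prediction with width 1 and with width \<open>h\<close> are linked through the same localization
    limits at \<open>h'\<close>.\<close>
  have "e_ubd =o minLLc h'" "pr_ubd =o supLLc h'"
    unfolding ubd_eq_LPr_one using LPr_eq_LLc[OF _ h', of "\<lambda>_. 1"] by auto
  then show "e_ubd =o minLPr h" "pr_ubd =o supLPr h"
    using L ordIso_symmetric ordIso_transitive by blast+
next
  fix h' :: "nat \<Rightarrow> nat" assume "\<forall>n. 1 \<le> h' n"
  then show "minIPr h =o minILc h'" "supIPr h =o supILc h'"
    using IPr_eq_ILc[OF assms] by auto
qed

end
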